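(* Let $J\subset\mathbb{R}^2$ be a Jordan curve which is the boundary of a compact convex subset $D\subset\mathbb{R}^{2}$. If $D$ is obtuse, then $J$ admits an inscribed square, i.e. there exist four points of $J$ which are the vertices of a square of side length $>0$.
   Context: A Jordan curve is the image of an injective continuous map $S^{1}\to\mathbb{R}^{2}$. A rectangle (in particular a square) is inscribed in a Jordan curve $C$ if all of its vertices lie on $C$. Identify $\mathbb{R}^2=\mathbb{C}$. For $x,v\in\mathbb{C}$ and an angle $\theta\geq 0$ put $$T_{v,\theta}(x):=\{x+r\cdot e^{i\phi}\cdot v:\phi\in[0,\theta]\text{ and }r\in[0,1]\}.$$ A subset $D\subset\mathbb{R}^2=\mathbb{C}$ is called obtuse if for every $x\in\partial D$ there exist $v\in\mathbb{C}\setminus\{0\}$ and an angle $\theta>\frac{\pi}{2}$ such that $T_{v,\theta}(x)\subset D$. *)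

theory Defs
  imports "HOL-Analysis.Analysis"
begin

text \<open>The plane is identified with the type \<^typ>\<open>complex\<close> throughout.\<close>

definition jordan_curve :: "complex set \<Rightarrow> bool" where
  "jordan_curve J \<longleftrightarrow>
     (\<exists>f :: complex \<Rightarrow> complex.
        continuous_on (sphere 0 1) f \<and> inj_on f (sphere 0 1) \<and> J = f ` sphere 0 1)"

definition circular_sector :: "complex \<Rightarrow> real \<Rightarrow> complex \<Rightarrow> complex set" where
  "circular_sector v \<theta> x =
     {x + of_real r * exp (\<i> * of_real \<phi>) * v | r \<phi>. \<phi> \<in> {0..\<theta>} \<and> r \<in> {0..1}}"

definition obtuse :: "complex set \<Rightarrow> bool" where
  "obtuse D \<longleftrightarrow>
     (\<forall>x \<in> frontier D. \<exists>v \<theta>. v \<noteq> 0 \<and> \<theta> > pi / 2 \<and> circular_sector v \<theta> x \<subseteq> D)"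

text \<open>The vertices \<open>a, b, c, d\<close> are listed in cyclic order; degenerate rectangles are allowed.\<close>

definition is_rectangle :: "complex \<Rightarrow> complex \<Rightarrow> complex \<Rightarrow> complex \<Rightarrow> bool" where
  "is_rectangle a b c d \<longleftrightarrow> b - a = c - d \<and> (b - a) \<bullet> (d - a) = 0"

definition is_square :: "complex \<Rightarrow> complex \<Rightarrow> complex \<Rightarrow> complex \<Rightarrow> bool" where
  "is_square a b c d \<longleftrightarrow> is_rectangle a b c d \<and> dist a b = dist a d"

end

theory Submission
  imports Defs
begin

text \<open>
  The squares are sought among those of maximal size. A square is described by its centre \<open>z\<close> and
  one half-diagonal \<open>w\<close>; its vertices in cyclic order are \<open>z + w\<close>, \<open>z + \<i>w\<close>, \<open>z - w\<close>, \<open>z - \<i>w\<close>.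
  The squares with all vertices in \<open>D\<close> form a compact convex set of pairs \<open>(z, w)\<close>, and the set
  \<open>P\<close> of their half-diagonals is compact and convex, has \<open>0\<close> in its interior, and is invariant
  under multiplication by \<open>\<i>\<close>. A square in \<open>D\<close> whose half-diagonal lies on the frontier of \<open>P\<close>
  is one of largest size among all squares in \<open>D\<close> with the same orientation.

  The key observation (\<open>opposite_vertices_on_frontier\<close>) is that such a largest square has two
  \<^emph>\<open>opposite\<close> vertices on the frontier of \<open>D\<close>: otherwise two adjacent vertices are interior points
  of \<open>D\<close>, sliding the square a little in the direction of these two puts all its vertices into the
  interior, and the square can be enlarged.

  Let \<open>A\<close> be the set of those \<open>w\<close> on the frontier of \<open>P\<close> for which some square in \<open>D\<close> has
  \<open>z + w\<close> and \<open>z - w\<close> on the frontier of \<open>D\<close>, and \<open>B\<close> the corresponding set for the other diagonal.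
  Both are closed, together they cover the frontier of \<open>P\<close>, and a quarter turn exchanges them.
  Since the frontier of \<open>P\<close> is connected, some \<open>w\<close> lies in both. This may give two different largest
  squares, with centres \<open>z\<^sub>1\<close> and \<open>z\<^sub>2\<close>, each responsible for one diagonal. But the square centred
  half-way between them is again a largest one, so it has two opposite vertices on the frontier of
  \<open>D\<close>. A frontier point of a convex set is never the midpoint of two of its points one of which is
  interior, hence the corresponding vertices of both squares are on the frontier as well, and one
  of the two squares is inscribed.

  Beyond compactness and convexity, the argument uses that \<open>D\<close> has an interior point. This is what
  obtuseness provides: a sector of angle more than \<open>\<pi>/2\<close> contains three points that do not lie on
  a line.
\<close>

section \<open>Squares with vertices in a convex set\<close>

definition squares_in :: "complex set \<Rightarrow> (complex \<times> complex) set" where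
  "squares_in D = {(z, w). z + w \<in> D \<and> z + \<i> * w \<in> D \<and> z - w \<in> D \<and> z - \<i> * w \<in> D}"

definition half_diagonals :: "complex set \<Rightarrow> complex set" where
  "half_diagonals D = snd ` squares_in D"

lemma half_diagonals_iff: "w \<in> half_diagonals D \<longleftrightarrow> (\<exists>z. (z, w) \<in> squares_in D)"
  by (force simp: half_diagonals_def)

lemma squares_in_eq_vimage:
  "squares_in D = (\<lambda>p. fst p + snd p) -` D \<inter> (\<lambda>p. fst p + \<i> * snd p) -` D
     \<inter> ((\<lambda>p. fst p - snd p) -` D \<inter> (\<lambda>p. fst p - \<i> * snd p) -` D)"
  by (auto simp: squares_in_def)

lemma convex_squares_in:
  assumes "convex D"
  shows "convex (squares_in D)"
  unfolding squares_in_eq_vimage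
  by (intro convex_Int convex_linear_vimage assms linearI)
     (simp_all add: algebra_simps)

lemma closed_squares_in:
  assumes "closed D"
  shows "closed (squares_in D)"
  unfolding squares_in_eq_vimage
  by (intro closed_Int closed_vimage assms continuous_intros)

text \<open>Two opposite vertices determine the square, and they range over the compact set \<open>D \<times> D\<close>.\<close>

lemma compact_squares_in:
  assumes "compact D"
  shows "compact (squares_in D)"
proof -
  define f :: "complex \<times> complex \<Rightarrow> complex \<times> complex"
    where "f = (\<lambda>p. ((fst p + snd p) / 2, (fst p - snd p) / 2))"
  have "squares_in D \<subseteq> f ` (D \<times> D)"
  proof
    fix p assume "p \<in> squares_in D"
    then obtain z w where "p = (z, w)" "z + w \<in> D" "z - w \<in> D"
      by (auto simp: squares_in_def)
    then show "p \<in> f ` (D \<times> D)"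
      by (intro image_eqI[of _ _ "(z + w, z - w)"]) (auto simp: f_def)
  qed
  moreover have "compact (f ` (D \<times> D))"
    unfolding f_def by (intro compact_continuous_image compact_Times assms continuous_intros) simp_all
  ultimately show ?thesis
    using closed_squares_in[OF compact_imp_closed[OF assms]]
    by (metis compact_Int_closed inf.absorb_iff2)
qed

lemma compact_half_diagonals: "compact D \<Longrightarrow> compact (half_diagonals D)"
  unfolding half_diagonals_def
  by (intro compact_continuous_image compact_squares_in continuous_intros)

lemma convex_half_diagonals: "convex D \<Longrightarrow> convex (half_diagonals D)"
  unfolding half_diagonals_def
  by (intro convex_linear_image convex_squares_in linear_snd)

lemma squares_in_quarter_turn: "(z, \<i> * w) \<in> squares_in D \<longleftrightarrow> (z, w) \<in> squares_in D"
  by (auto simp: squares_in_def mult.assoc[symmetric])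

lemma quarter_turn_half_diagonals: "(*) \<i> ` half_diagonals D = half_diagonals D"
proof -
  have mem: "\<i> * w \<in> half_diagonals D \<longleftrightarrow> w \<in> half_diagonals D" for w
    by (simp add: half_diagonals_iff squares_in_quarter_turn)
  have "w \<in> (*) \<i> ` half_diagonals D" if "w \<in> half_diagonals D" for w
  proof
    show "w = \<i> * (- \<i> * w)"
      by simp
    then show "- \<i> * w \<in> half_diagonals D"
      using that mem by metis
  qed
  then show ?thesis
    using mem by auto
qed

lemma quarter_turn_frontier_half_diagonals:
  assumes "w \<in> frontier (half_diagonals D)"
  shows "\<i> * w \<in> frontier (half_diagonals D)"
proof -
  have inj: "inj ((*) \<i>)"
    by (simp add: inj_on_def)
  have "frontier ((*) \<i> ` half_diagonals D) = (*) \<i> ` frontier (half_diagonals D)"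
    unfolding frontier_def image_set_diff[OF inj]
    by (subst closure_injective_linear_image[OF _ inj], simp add: linear_iff algebra_simps,
        subst interior_injective_linear_image[OF _ inj], simp_all add: linear_iff algebra_simps)
  then show ?thesis
    using assms by (metis imageI quarter_turn_half_diagonals)
qed

text \<open>A square strictly inside \<open>D\<close> can be turned and enlarged a little about its centre.\<close>

lemma interior_half_diagonals:
  assumes "(z, w) \<in> squares_in (interior D)"
  shows "w \<in> interior (half_diagonals D)"
proof -
  define U where "U = Pair z -` squares_in (interior D)"
  have "open (squares_in (interior D))"
    unfolding squares_in_eq_vimage by (intro open_Int open_vimage continuous_intros) simp_all
  then have "open U"
    unfolding U_def by (intro open_vimage continuous_intros)
  moreover have "U \<subseteq> half_diagonals D"
    using interior_subset[of D] unfolding U_def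
    by (auto simp: half_diagonals_iff squares_in_def intro!: exI[of _ z])
  moreover have "w \<in> U"
    using assms by (simp add: U_def)
  ultimately show ?thesis
    by (meson interiorI)
qed

section \<open>Largest squares of a given orientation\<close>

text \<open>
  The points \<open>z + u\<close> and \<open>z + v\<close> are adjacent vertices of the parallelogram. A translation by a
  small positive multiple of \<open>u + v\<close> moves \<open>z - v\<close> along the side towards \<open>z + u\<close>, and \<open>z - u\<close> along
  the side towards \<open>z + v\<close>, hence both into the interior.
\<close>

lemma slide_into_interior:
  fixes D :: "'a::euclidean_space set"
  assumes "convex D" and u: "z + u \<in> interior D" and v: "z + v \<in> interior D"
    and "z - u \<in> D" "z - v \<in> D"
  shows "\<exists>z'. {z' + u, z' + v, z' - u, z' - v} \<subseteq> interior D"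
proof -
  have "eventually (\<lambda>e. z + u + e *\<^sub>R (u + v) \<in> interior D) (at_right (0::real))"
    by (rule topological_tendstoD[OF _ open_interior u]) (auto intro!: tendsto_eq_intros)
  moreover have "eventually (\<lambda>e. z + v + e *\<^sub>R (u + v) \<in> interior D) (at_right (0::real))"
    by (rule topological_tendstoD[OF _ open_interior v]) (auto intro!: tendsto_eq_intros)
  moreover have "eventually (\<lambda>e. e \<in> {0<..<1}) (at_right (0::real))"
    by (rule eventually_at_right_real) simp
  ultimately have "eventually (\<lambda>e. z + u + e *\<^sub>R (u + v) \<in> interior D
      \<and> z + v + e *\<^sub>R (u + v) \<in> interior D \<and> e \<in> {0<..<1}) (at_right (0::real))"
    by eventually_elim simp
  from eventually_happens'[OF _ this] obtain e :: real where e: "0 < e" "e < 1"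
    and ev: "z + u + e *\<^sub>R (u + v) \<in> interior D" "z + v + e *\<^sub>R (u + v) \<in> interior D"
    by auto
  have "(z - v) - e *\<^sub>R ((z - v) - (z + u)) \<in> interior D"
    using assms e by (intro mem_interior_convex_shrink) auto
  moreover have "(z - u) - e *\<^sub>R ((z - u) - (z + v)) \<in> interior D"
    using assms e by (intro mem_interior_convex_shrink) auto
  ultimately show ?thesis
    using ev by (intro exI[of _ "z + e *\<^sub>R (u + v)"]) (simp add: algebra_simps)
qed

text \<open>
  If neither diagonal has both ends on the frontier of \<open>D\<close>, then each has an interior end, and these
  two ends are adjacent vertices. Sliding the square towards them contradicts its maximality.
\<close>

lemma opposite_vertices_on_frontier:
  assumes "convex D" and sq: "(z, w) \<in> squares_in D"
    and w: "w \<in> frontier (half_diagonals D)"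
  shows "z + w \<in> frontier D \<and> z - w \<in> frontier D
    \<or> z + \<i> * w \<in> frontier D \<and> z - \<i> * w \<in> frontier D"
proof (rule ccontr)
  have D: "z + w \<in> D" "z - w \<in> D" "z + \<i> * w \<in> D" "z - \<i> * w \<in> D"
    using sq by (auto simp: squares_in_def)
  have front: "x \<in> frontier D \<or> x \<in> interior D" if "x \<in> D" for x
    using that closure_subset by (auto simp: frontier_def)
  assume neg: "\<not> ?thesis"
  then have "z + w \<in> interior D \<or> z - w \<in> interior D"
    using D front by blast
  then obtain u where u: "u = w \<or> u = - w" "z + u \<in> interior D"
    by (metis add_uminus_conv_diff)
  have "z + \<i> * w \<in> interior D \<or> z - \<i> * w \<in> interior D"
    using neg D front by blast
  then obtain v where v: "v = \<i> * w \<or> v = - (\<i> * w)" "z + v \<in> interior D"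
    by (metis add_uminus_conv_diff)
  have "z - u \<in> D" "z - v \<in> D"
    using u v D by auto
  then obtain z' where "{z' + u, z' + v, z' - u, z' - v} \<subseteq> interior D"
    using slide_into_interior[OF \<open>convex D\<close> u(2) v(2)] by blast
  then have "(z', w) \<in> squares_in (interior D)"
    using u(1) v(1) by (auto simp: squares_in_def)
  then show False
    using interior_half_diagonals w by (auto simp: frontier_def)
qed

lemma frontier_midpoint_convex:
  fixes D :: "'a::euclidean_space set"
  assumes "convex D" "x \<in> D" "y \<in> D" and mid: "midpoint x y \<in> frontier D"
  shows "x \<in> frontier D"
proof -
  have "midpoint x y \<in> interior D" if "x \<in> interior D"
  proof -
    have "y - (1/2) *\<^sub>R (y - x) = midpoint x y"
      by (simp add: euclidean_eq_iff[where 'a = 'a] midpoint_def inner_simps field_simps)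
    then show ?thesis
      using mem_interior_convex_shrink[OF \<open>convex D\<close> that \<open>y \<in> D\<close>, of "1/2"] by simp
  qed
  then show ?thesis
    using assms closure_subset by (auto simp: frontier_def)
qed

section \<open>Inscribed squares\<close>

lemma frontier_half_diagonals:
  assumes "compact D" "convex D" "interior D \<noteq> {}"
  shows "0 \<in> interior (half_diagonals D)"
    and "connected (frontier (half_diagonals D))"
    and "frontier (half_diagonals D) \<noteq> {}"
proof -
  obtain x where "x \<in> interior D"
    using assms by blast
  \<comment> \<open>A point is a square with half-diagonal \<open>0\<close>.\<close>
  then have "(x, 0) \<in> squares_in (interior D)"
    by (simp add: squares_in_def)
  then show zero: "0 \<in> interior (half_diagonals D)"
    by (rule interior_half_diagonals)
  then have ne: "interior (half_diagonals D) \<noteq> {}"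
    by blast
  have bnd: "bounded (half_diagonals D)"
    using assms compact_half_diagonals compact_imp_bounded by blast
  show "connected (frontier (half_diagonals D))"
    using connected_sphere_gen[OF convex_half_diagonals[OF \<open>convex D\<close>] bnd] ne
    by (simp add: rel_frontier_nonempty_interior aff_dim_nonempty_interior)
  show "frontier (half_diagonals D) \<noteq> {}"
    using bnd ne frontier_eq_empty interior_empty not_bounded_UNIV by metis
qed

theorem convex_inscribed_square:
  assumes "compact D" "convex D" "interior D \<noteq> {}"
  shows "\<exists>z w. w \<noteq> 0 \<and> {z + w, z + \<i> * w, z - w, z - \<i> * w} \<subseteq> frontier D"
proof -
  let ?F = "frontier (half_diagonals D)"
  define A where "A = snd ` (squares_in D \<inter> {p. fst p + snd p \<in> frontier D \<and> fst p - snd p \<in> frontier D})"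
  define B where
    "B = snd ` (squares_in D \<inter> {p. fst p + \<i> * snd p \<in> frontier D \<and> fst p - \<i> * snd p \<in> frontier D})"
  have A_iff: "w \<in> A \<longleftrightarrow> (\<exists>z. (z, w) \<in> squares_in D \<and> z + w \<in> frontier D \<and> z - w \<in> frontier D)" for w
    by (force simp: A_def)
  have B_iff: "w \<in> B \<longleftrightarrow>
      (\<exists>z. (z, w) \<in> squares_in D \<and> z + \<i> * w \<in> frontier D \<and> z - \<i> * w \<in> frontier D)" for w
    by (force simp: B_def)
  have "compact A" "compact B"
    unfolding A_def B_def using assms(1)
    by (auto intro!: compact_continuous_image compact_Int_closed compact_squares_in
        closed_Collect_conj continuous_closed_vimage continuous_intros
        closed_vimage[unfolded vimage_def])
  then have closed: "closed A" "closed B"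
    by (simp_all add: compact_imp_closed)
  have cover: "?F \<subseteq> A \<union> B"
  proof
    fix w assume w: "w \<in> ?F"
    then have "w \<in> half_diagonals D"
      using assms(1) compact_half_diagonals compact_imp_closed frontier_subset_closed by blast
    then obtain z where "(z, w) \<in> squares_in D"
      by (auto simp: half_diagonals_iff)
    then show "w \<in> A \<union> B"
      using opposite_vertices_on_frontier[OF assms(2) _ w] by (auto simp: A_iff B_iff)
  qed
  have turn: "\<i> * w \<in> B" if "w \<in> A" for w
    using that by (auto simp: A_iff B_iff squares_in_quarter_turn mult.assoc[symmetric])
  have turn': "\<i> * w \<in> A" if "w \<in> B" for w
    using that by (auto simp: A_iff B_iff squares_in_quarter_turn)
  have "A \<inter> ?F \<noteq> {} \<and> B \<inter> ?F \<noteq> {}"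
    using frontier_half_diagonals(3)[OF assms] cover turn turn'
      quarter_turn_frontier_half_diagonals by blast
  then obtain w where w: "w \<in> ?F" "w \<in> A" "w \<in> B"
    using connected_closedD[OF frontier_half_diagonals(2)[OF assms] _ cover closed]
    by blast
  then obtain z1 z2
    where z1: "(z1, w) \<in> squares_in D" "z1 + w \<in> frontier D" "z1 - w \<in> frontier D"
      and z2: "(z2, w) \<in> squares_in D" "z2 + \<i> * w \<in> frontier D" "z2 - \<i> * w \<in> frontier D"
    by (auto simp: A_iff B_iff)
  define z where "z = midpoint z1 z2"
  have mid: "midpoint (z1 + c) (z2 + c) = z + c" "midpoint (z2 + c) (z1 + c) = z + c"
    "midpoint (z1 - c) (z2 - c) = z - c" "midpoint (z2 - c) (z1 - c) = z - c" for c
    by (simp_all add: z_def midpoint_def scaleR_conv_of_real field_simps)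
  have D: "z1 + w \<in> D" "z1 - w \<in> D" "z1 + \<i> * w \<in> D" "z1 - \<i> * w \<in> D"
    "z2 + w \<in> D" "z2 - w \<in> D" "z2 + \<i> * w \<in> D" "z2 - \<i> * w \<in> D"
    using z1(1) z2(1) by (auto simp: squares_in_def)
  have "midpoint (z1, w) (z2, w) \<in> squares_in D"
    using closed_segment_subset[OF z1(1) z2(1) convex_squares_in[OF assms(2)]]
    by (rule subsetD) simp
  moreover have "midpoint (z1, w) (z2, w) = (z, w)"
    by (simp add: z_def midpoint_def scaleR_conv_of_real field_simps)
  ultimately have "z + w \<in> frontier D \<and> z - w \<in> frontier D
      \<or> z + \<i> * w \<in> frontier D \<and> z - \<i> * w \<in> frontier D"
    using opposite_vertices_on_frontier assms(2) w(1) by auto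
  then have "\<exists>c. {c + w, c + \<i> * w, c - w, c - \<i> * w} \<subseteq> frontier D"
  proof (elim disjE conjE)
    assume "z + w \<in> frontier D" "z - w \<in> frontier D"
    then have "z2 + w \<in> frontier D" "z2 - w \<in> frontier D"
      using frontier_midpoint_convex[OF assms(2)] D mid by metis+
    with z2 show ?thesis by blast
  next
    assume "z + \<i> * w \<in> frontier D" "z - \<i> * w \<in> frontier D"
    then have "z1 + \<i> * w \<in> frontier D" "z1 - \<i> * w \<in> frontier D"
      using frontier_midpoint_convex[OF assms(2)] D mid by metis+
    with z1 show ?thesis by blast
  qed
  \<comment> \<open>A point square is not of largest size, since \<open>D\<close> has interior points.\<close>
  moreover have "w \<noteq> 0"
    using w(1) frontier_half_diagonals(1)[OF assms] by (auto simp: frontier_def)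
  ultimately show ?thesis
    by blast
qed

text \<open>
  The sector at a frontier point \<open>x\<close> contains \<open>x\<close>, \<open>x + v\<close> and \<open>x + \<i>v\<close>. A line through these points
  would have a normal vector orthogonal to both \<open>v\<close> and \<open>\<i>v\<close>.
\<close>

lemma obtuse_interior_nonempty:
  assumes "convex D" "obtuse D" "frontier D \<noteq> {}"
  shows "interior D \<noteq> {}"
proof
  assume "interior D = {}"
  then obtain a b where a: "a \<noteq> 0" "D \<subseteq> {x. a \<bullet> x = b}"
    using empty_interior_subset_hyperplane[OF assms(1)] by metis
  obtain x v \<theta> where v: "v \<noteq> 0" "\<theta> > pi / 2" "circular_sector v \<theta> x \<subseteq> D"
    using assms(2,3) unfolding obtuse_def by blast
  have sector: "x + of_real r * exp (\<i> * of_real \<phi>) * v \<in> D"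
    if "\<phi> \<in> {0..\<theta>}" "r \<in> {0..1}" for r \<phi>
    using v(3) that unfolding circular_sector_def by blast
  have "\<theta> \<ge> 0"
    using v(2) pi_gt_zero by linarith
  then have "x \<in> D" "x + v \<in> D" "x + \<i> * v \<in> D"
    using sector[of 0 0] sector[of 0 1] sector[of "pi / 2" 1] v(2)
    by (simp_all add: exp_Euler cos_of_real sin_of_real flip: of_real_divide)
  then have "a \<bullet> x = b" "a \<bullet> (x + v) = b" "a \<bullet> (x + \<i> * v) = b"
    using a(2) by blast+
  then have "a \<bullet> v = 0" "a \<bullet> (\<i> * v) = 0"
    by (simp_all add: inner_add_right)
  then have "Re a * Re v + Im a * Im v = 0" "Im a * Re v = Re a * Im v"
    by (simp_all add: inner_complex_def)
  then have "(Re a)\<^sup>2 * ((Re v)\<^sup>2 + (Im v)\<^sup>2) = 0" "(Im a)\<^sup>2 * ((Re v)\<^sup>2 + (Im v)\<^sup>2) = 0"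
    by algebra+
  then show False
    using a(1) v(1) by (auto simp: complex_eq_iff)
qed

theorem theorem1p5:
  fixes J D :: "complex set"
  assumes "jordan_curve J"
    and "compact D"
    and "convex D"
    and "J = frontier D"
    and "obtuse D"
  shows "\<exists>a b c d. {a, b, c, d} \<subseteq> J \<and> is_square a b c d \<and> dist a b > 0"
proof -
  have "frontier D \<noteq> {}"
    using assms(1,4) by (auto simp: jordan_curve_def)
  then obtain z w where w: "w \<noteq> 0" and sub: "{z + w, z + \<i> * w, z - w, z - \<i> * w} \<subseteq> frontier D"
    using convex_inscribed_square[OF assms(2,3) obtuse_interior_nonempty[OF assms(3,5)]] by blast
  have "is_square (z + w) (z + \<i> * w) (z - w) (z - \<i> * w)"
    by (simp add: is_square_def is_rectangle_def inner_complex_def dist_norm cmod_def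
        algebra_simps power2_eq_square)
  moreover have "dist (z + w) (z + \<i> * w) > 0"
    using w by (auto simp: complex_eq_iff)
  moreover note sub[folded assms(4)]
  ultimately show ?thesis
    by blast
qed

end
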